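(* Let $q$ be a prime power and let $\mathbb{L}$ be a maximum scattered $\mathbb{F}_q$-linear set in $\mathrm{PG}(1,q^5)$, not of pseudoregulus type. Let $\Lambda$ be a plane of $\mathrm{PG}(4,q^5)$ with $\Lambda\cap\Sigma=\emptyset$ such that $\mathbb{L}$ is the projection of the standard subgeometry $\Sigma$ with vertex $\Lambda$. Assume that the point $\Lambda\cap\Lambda^{\sigma}$ has height four. Then there exist $\alpha,\beta\in\mathbb{F}_{q^5}$ with $\alpha^q\neq\beta^{q+1}$ such that $\mathbb{L}$ is projectively equivalent to $$L_{\alpha,\beta}=\{\langle(x-\alpha x^{q^2},\,x^q-\beta x^{q^2})\rangle_{\mathbb{F}_{q^5}}: x\in\mathbb{F}_{q^5}^*\}.$$
   Context: For an $\mathbb{F}_q$-subspace $U$ of a two-dimensional $\mathbb{F}_{q^5}$-vector space, the associated $\mathbb{F}_q$-linear set in $\mathrm{PG}(1,q^5)$ is $L_U=\{\langle v\rangle_{\mathbb{F}_{q^5}}: v\in U\setminus\{0\}\}$; its rank is $\dim_{\mathbb{F}_q}U$. A linear set of rank $r$ is scattered if it has exactly $(q^r-1)/(q-1)$ points; a scattered linear set of rank $5$ in $\mathrm{PG}(1,q^5)$ is maximum scattered. A linear set is of pseudoregulus type if it is projectively equivalent to $\{\langle(u,u^q)\rangle_{\mathbb{F}_{q^5}}: u\in\mathbb{F}_{q^5}^*\}$. Projectively equivalent means equivalent under $\mathrm{PGL}(2,q^5)$. The standard subgeometry is $\Sigma=\{\langle(u,u^q,u^{q^2},u^{q^3},u^{q^4})\rangle_{\mathbb{F}_{q^5}}: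 u\in\mathbb{F}_{q^5}^*\}\subseteq\mathrm{PG}(4,q^5)$, and $\sigma:\langle(X_0,X_1,X_2,X_3,X_4)\rangle\mapsto\langle(X_4^q,X_0^q,X_1^q,X_2^q,X_3^q)\rangle$ is a collineation of order five fixing $\Sigma$ pointwise. The projection of $\Sigma$ with vertex a plane $\Lambda$ with $\Lambda\cap\Sigma=\emptyset$ is the set of points $\overline{\Lambda\cup\{P\}}\cap\ell$, $P\in\Sigma$, where $\ell$ is a line disjoint from $\Lambda$, identified with $\mathrm{PG}(1,q^5)$ (so it is determined up to projective equivalence); $\overline{S}$ denotes the projective span. It is known that every maximum scattered linear set of $\mathrm{PG}(1,q^5)$ arises as such a projection and that, when it is not of pseudoregulus type, $\Lambda\cap\Lambda^{\tau}$ is a point for every generator $\tau$ of $\langle\sigma\rangle$. The height of a point $P$ of $\mathrm{PG}(4,q^5)$ is the projective dimension of the span of $P,P^\sigma,P^{\sigma^2},P^{\sigma^3},P^{\sigma^4}$. *)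

theory Defs
  imports "HOL-Analysis.Analysis" "HOL-Number_Theory.Prime_Powers"
begin

text \<open>
  Throughout, \<^typ>\<open>'a\<close> is a finite field which the theorems assume to have
  \<open>q ^ 5\<close> elements.  The geometry \<open>PG(n-1, q ^ 5)\<close> is the lattice of
  \<^typ>\<open>'a\<close>-subspaces of \<open>'a ^ n\<close>: subspaces of projective dimension \<open>d\<close> have vector
  dimension \<open>d + 1\<close>, points are the lines through the origin \<open>vec.span {v}\<close> with \<open>v \<noteq> 0\<close>,
  and the point \<open>P\<close> lies on \<open>W\<close> iff \<open>P \<subseteq> W\<close>.
\<close>

definition proj_dim :: "('a::field ^ 'n) set \<Rightarrow> int" where
  "proj_dim W = int (vec.dim W) - 1"

definition proj_line :: "('a::field ^ 'n) set \<Rightarrow> bool" where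
  "proj_line W \<longleftrightarrow> vec.subspace W \<and> proj_dim W = 1"

definition proj_plane :: "('a::field ^ 'n) set \<Rightarrow> bool" where
  "proj_plane W \<longleftrightarrow> vec.subspace W \<and> proj_dim W = 2"

definition proj_equiv :: "('a::field ^ 'n) set set \<Rightarrow> ('a ^ 'n) set set \<Rightarrow> bool" where
  "proj_equiv L M \<longleftrightarrow> (\<exists>A :: 'a ^ 'n ^ 'n. invertible A \<and> M = (\<lambda>P. (\<lambda>v. A *v v) ` P) ` L)"


subsection \<open>Linear sets\<close>

text \<open>
  The subfield with \<open>q\<close> elements is \<open>{c. c ^ q = c}\<close>.  It is not a type, so the linear algebra
  over it (subspace, span, basis) is spelled out here.
\<close>

definition Fq :: "nat \<Rightarrow> 'a::field set" where
  "Fq q = {c. c ^ q = c}"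

definition Fq_subspace :: "nat \<Rightarrow> ('a::field ^ 'n) set \<Rightarrow> bool" where
  "Fq_subspace q U \<longleftrightarrow>
     0 \<in> U \<and> (\<forall>x\<in>U. \<forall>y\<in>U. x + y \<in> U) \<and> (\<forall>c\<in>Fq q. \<forall>x\<in>U. c *s x \<in> U)"

definition Fq_span :: "nat \<Rightarrow> ('a::field ^ 'n) set \<Rightarrow> ('a ^ 'n) set" where
  "Fq_span q B = Fq_subspace q hull B"

definition Fq_independent :: "nat \<Rightarrow> ('a::field ^ 'n) set \<Rightarrow> bool" where
  "Fq_independent q B \<longleftrightarrow> (\<forall>b\<in>B. b \<notin> Fq_span q (B - {b}))"

definition has_Fq_dim :: "nat \<Rightarrow> ('a::field ^ 'n) set \<Rightarrow> nat \<Rightarrow> bool" where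
  "has_Fq_dim q U r \<longleftrightarrow>
     (\<exists>B. finite B \<and> card B = r \<and> Fq_independent q B \<and> Fq_span q B = U)"

definition linear_set :: "('a::field ^ 'n) set \<Rightarrow> ('a ^ 'n) set set" where
  "linear_set U = {vec.span {v} | v. v \<in> U - {0}}"

definition scattered_linear_set :: "nat \<Rightarrow> nat \<Rightarrow> ('a::field ^ 2) set set \<Rightarrow> bool" where
  "scattered_linear_set q r L \<longleftrightarrow>
     (\<exists>U. Fq_subspace q U \<and> has_Fq_dim q U r \<and> L = linear_set U) \<and>
     card L = (q ^ r - 1) div (q - 1)"

definition maximum_scattered :: "nat \<Rightarrow> ('a::field ^ 2) set set \<Rightarrow> bool" where
  "maximum_scattered q L \<longleftrightarrow> scattered_linear_set q 5 L"

definition pseudoregulus_type :: "nat \<Rightarrow> ('a::field ^ 2) set set \<Rightarrow> bool" where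
  "pseudoregulus_type q L \<longleftrightarrow> proj_equiv L {vec.span {vector [u, u ^ q]} | u. u \<noteq> 0}"

definition L_alpha_beta :: "nat \<Rightarrow> 'a::field \<Rightarrow> 'a \<Rightarrow> ('a ^ 2) set set" where
  "L_alpha_beta q \<alpha> \<beta> =
     {vec.span {vector [x - \<alpha> * x ^ q ^ 2, x ^ q - \<beta> * x ^ q ^ 2]} | x. x \<noteq> 0}"


subsection \<open>The standard subgeometry of the four-dimensional space and its projections\<close>

definition subgeometry :: "nat \<Rightarrow> ('a::field ^ 5) set set" where
  "subgeometry q =
     {vec.span {vector [u, u ^ q, u ^ q ^ 2, u ^ q ^ 3, u ^ q ^ 4]} | u. u \<noteq> 0}"

text \<open>
  The index type \<^typ>\<open>5\<close> is cyclic, so \<open>i - 1\<close> is a cyclic shift;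
  \<open>frob_shift_vector\<close> below shows the map in coordinates.  It acts on subspaces by taking images.
\<close>

definition frob_shift :: "nat \<Rightarrow> 'a::field ^ 5 \<Rightarrow> 'a ^ 5" where
  "frob_shift q X = (\<chi> i. (X $ (i - 1)) ^ q)"

lemma frob_shift_vector:
  fixes X0 :: "'a::field"
  shows "frob_shift q (vector [X0, X1, X2, X3, X4]) = vector [X4 ^ q, X0 ^ q, X1 ^ q, X2 ^ q, X3 ^ q]"
proof -
  have "i = 0 \<or> i = 1 \<or> i = 2 \<or> i = 3 \<or> i = 4" for i :: 5
  proof (cases i)
    case (of_int z)
    then have "z = 0 \<or> z = 1 \<or> z = 2 \<or> z = 3 \<or> z = 4" by auto
    with of_int show ?thesis by auto
  qed
  then show ?thesis
    unfolding vec_eq_iff frob_shift_def vector_def by force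
qed

text \<open>
  A projection with vertex \<open>\<Lambda>\<close> lives on a line \<open>l\<close> disjoint from \<open>\<Lambda>\<close>, which is identified
  with \<open>PG(1, q ^ 5)\<close> by a linear isomorphism \<open>g\<close> from \<open>'a ^ 2\<close> onto \<open>l\<close>.
\<close>

definition projection_on :: "nat \<Rightarrow> ('a::field ^ 5) set \<Rightarrow> ('a ^ 5) set \<Rightarrow> ('a ^ 5) set set" where
  "projection_on q \<Lambda> l = {vec.span (\<Lambda> \<union> P) \<inter> l | P. P \<in> subgeometry q}"

definition is_projection :: "nat \<Rightarrow> ('a::field ^ 5) set \<Rightarrow> ('a ^ 2) set set \<Rightarrow> bool" where
  "is_projection q \<Lambda> L \<longleftrightarrow>
     (\<exists>l g. proj_line l \<and> \<Lambda> \<inter> l = {0} \<and>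
        Vector_Spaces.linear (*s) (*s) g \<and> inj g \<and> range g = l \<and>
        (\<lambda>P. g ` P) ` L = projection_on q \<Lambda> l)"

definition height :: "nat \<Rightarrow> ('a::field ^ 5) set \<Rightarrow> int" where
  "height q P = proj_dim (vec.span (\<Union>i<5. (frob_shift q ^^ i) ` P))"

end

theory Submission
  imports Defs
begin

text \<open>
  Write \<open>\<sigma>\<close> for the collineation \<open>frob_shift q\<close>.  The height condition produces a vector \<open>v\<close>
  such that \<open>v\<close> and \<open>\<sigma> v\<close> lie in the vertex \<open>\<Lambda>\<close> and \<open>v, \<sigma> v, \<dots>, \<sigma>\<^sup>4 v\<close> is a basis
  (\<open>vertex_contains_consecutive_pair\<close>).  If \<open>\<Lambda> \<inter> \<Lambda>\<^sup>\<sigma>\<close> is a point, \<open>v\<close> is its preimage under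
  \<open>\<sigma>\<close>; if it is larger, then \<open>\<Lambda>\<close> itself is spanned by some \<open>v, \<sigma> v, \<sigma>\<^sup>2 v\<close>, because a
  nonzero \<open>\<sigma>\<close>-invariant subspace contains a point of the subgeometry
  (\<open>invariant_subspace_meets_subgeometry\<close>), and \<open>\<Lambda>\<close> contains none.

  In the basis \<open>\<sigma>\<^sup>i v\<close> the points of the subgeometry are the sums
  \<open>\<Sum>i<5. y ^ q ^ i \<cdot> \<sigma>\<^bsup>i + 2\<^esup> v\<close> with \<open>y \<noteq> 0\<close> (\<open>subgeometry_orbit_sums\<close>).  The projection is a
  linear map onto \<open>'a ^ 2\<close> with kernel \<open>\<Lambda>\<close> (\<open>projection_linear_map\<close>); it kills
  \<open>\<sigma>\<^sup>5 v = v\<close> and \<open>\<sigma>\<^sup>6 v = \<sigma> v\<close>, so the linear set consists of the points spanned by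
  \<open>y a + y ^ q b + y ^ q ^ 2 c\<close> with \<open>y \<noteq> 0\<close>, where \<open>a, b, c\<close> span \<open>'a ^ 2\<close>.

  It remains to treat these linear sets (\<open>three_term_linear_set\<close>).
    \<^item> If \<open>a, b\<close> is a basis, then coordinates with respect to it give \<open>L_alpha_beta\<close> at once, and
      \<open>\<alpha> ^ q = \<beta> ^ (q + 1)\<close> would make the second coordinate the \<open>q\<close>-th power of a combination of
      both, hence the set of pseudoregulus type (\<open>pseudoregulus_type_degenerate\<close>).
    \<^item> If \<open>b = 0\<close>, the set consists of the points \<open>(y, y ^ q ^ 2)\<close> and is again of pseudoregulus
      type (\<open>point_set_frob_twice\<close>).
    \<^item> If \<open>a = t b\<close> with \<open>b \<noteq> 0\<close>, the set consists of the points
      \<open>(z, t z ^ q ^ 3 + z ^ q ^ 4)\<close>.  A linearized polynomial and its adjoint for the trace form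
      define the same linear set (\<open>point_set_adjoint\<close>), and the adjoint has the form required,
      with \<open>\<alpha> = 0\<close> and with \<open>\<beta> \<noteq> 0\<close> unless \<open>t = 0\<close>, which once more is the pseudoregulus type.
\<close>

section \<open>Projective equivalence of parametrized point sets\<close>

definition point_set :: "('a::field \<Rightarrow> 'a ^ 'n) \<Rightarrow> ('a ^ 'n) set set" where
  "point_set f = {vec.span {f x} | x. x \<noteq> 0}"

lemma proj_equiv_trans:
  assumes "proj_equiv L M" and "proj_equiv M N"
  shows "proj_equiv L N"
proof -
  obtain A B where A: "invertible A" "M = (\<lambda>P. (\<lambda>v. A *v v) ` P) ` L"
    and B: "invertible B" "N = (\<lambda>P. (\<lambda>v. B *v v) ` P) ` M"
    using assms unfolding proj_equiv_def by blast
  have "N = (\<lambda>P. (\<lambda>v. (B ** A) *v v) ` P) ` L"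
    unfolding A(2) B(2) image_image by (simp add: matrix_vector_mul_assoc)
  then show ?thesis
    unfolding proj_equiv_def using invertible_mult[OF B(1) A(1)] by blast
qed

lemma proj_equiv_sym:
  assumes "proj_equiv L M"
  shows "proj_equiv M L"
proof -
  obtain A where A: "invertible A" "M = (\<lambda>P. (\<lambda>v. A *v v) ` P) ` L"
    using assms unfolding proj_equiv_def by blast
  obtain B where B: "A ** B = mat 1" "B ** A = mat 1"
    using A(1) unfolding invertible_def by blast
  have "L = (\<lambda>P. (\<lambda>v. B *v v) ` P) ` M"
    unfolding A(2) image_image by (simp add: matrix_vector_mul_assoc B)
  then show ?thesis
    unfolding proj_equiv_def using B invertible_def by blast
qed

lemma proj_equiv_point_set:
  assumes "invertible A" and "\<And>x. x \<noteq> 0 \<Longrightarrow> A *v f x = g x"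
  shows "proj_equiv (point_set f) (point_set g)"
proof -
  have "(\<lambda>v. A *v v) ` vec.span {f x} = vec.span {A *v f x}" for x
    using vec.linear_span_image[OF matrix_vector_mul_linear_gen, of A "{f x}"] by simp
  then have "point_set g = (\<lambda>P. (\<lambda>v. A *v v) ` P) ` point_set f"
    unfolding point_set_def using assms(2) by (fastforce simp: image_iff)
  then show ?thesis
    unfolding proj_equiv_def using assms(1) by blast
qed

lemma point_set_reparam:
  fixes f :: "'a::{field,finite} \<Rightarrow> 'a ^ 'n"
  assumes "inj \<phi>" and "\<phi> 0 = 0"
  shows "point_set (\<lambda>x. f (\<phi> x)) = point_set f"
proof -
  have "surj \<phi>"
    using assms(1) by (simp add: finite_UNIV_inj_surj)
  have "\<phi> x = 0 \<longleftrightarrow> x = 0" for x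
    using assms by (metis injD)
  then show ?thesis
    unfolding point_set_def using \<open>surj \<phi>\<close> by (metis (no_types, opaque_lifting) surjD)
qed

lemma invertible_from_spanning_pair:
  fixes a b :: "'a::field ^ 2"
  assumes "vec.span {a, b} = UNIV"
  obtains M :: "'a ^ 2 ^ 2" where "invertible M"
    and "\<And>x y. M *v vector [x, y] = x *s a + y *s b"
proof -
  define M :: "'a ^ 2 ^ 2" where "M = (\<chi> i j. if j = 1 then a $ i else b $ i)"
  have M: "M *v vector [x, y] = x *s a + y *s b" for x y
    unfolding M_def matrix_vector_mult_def vec_eq_iff by (simp add: sum_2 forall_2 mult.commute)
  have "v \<in> range (\<lambda>z. M *v z)" for v
  proof -
    have "v \<in> vec.span {a, b}"
      using assms by simp
    then obtain x y where "v - x *s a = y *s b"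
      unfolding vec.span_breakdown_eq vec.span_singleton by auto
    then have "v = M *v vector [x, y]"
      unfolding M by (simp add: algebra_simps)
    then show ?thesis by blast
  qed
  then have "invertible M"
    unfolding invertible_right_inverse matrix_right_invertible_surjective by blast
  with M that show thesis by blast
qed

lemma span_UNIV_if_dim:
  fixes S :: "('a::field ^ 'n) set"
  assumes "vec.dim S = CARD('n)"
  shows "vec.span S = UNIV"
  using assms by (metis vec.dim_eq_full vec.span_UNIV vec_dim_card)

lemma span_pair_UNIV:
  fixes a b :: "'a::field ^ 2"
  assumes "b \<noteq> 0" and "a \<notin> vec.span {b}"
  shows "vec.span {a, b} = UNIV"
proof -
  have "vec.dim {a, b} = 2"
    using assms by (simp add: vec.dim_insert)
  then show ?thesis
    by (intro span_UNIV_if_dim) simp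
qed

section \<open>Frobenius powers and the trace form\<close>

text \<open>
  The argument of type \<^typ>\<open>'a itself\<close> names the field, which the facts about \<open>q\<close> alone
  would otherwise leave undetermined.
\<close>

locale quintic_extension =
  fixes q :: nat and F :: "'a::{field,finite} itself"
  assumes primepow_q: "primepow q" and card_F: "CARD('a) = q ^ 5"
begin

lemma q_gt_1: "q > 1"
  using primepow_gt_Suc_0[OF primepow_q] by simp

lemma frob_0 [simp]: "(0::'a) ^ q ^ i = 0"
  using q_gt_1 by (simp add: power_0_left)

lemma frob_add: "(x + y :: 'a) ^ q ^ i = x ^ q ^ i + y ^ q ^ i"
proof -
  obtain p k where p: "prime p" "q = p ^ k"
    using primepow_q unfolding primepow_def by blast
  have "prime CHAR('a)"
    by (rule prime_CHAR_semidom) (simp add: finite_imp_CHAR_pos)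
  moreover have "CHAR('a) dvd p ^ (k * 5)"
  proof -
    \<comment> \<open>Translation by \<open>1\<close> permutes the field, so its cardinality vanishes in it.\<close>
    have "(\<Sum>x\<in>UNIV. x + 1 :: 'a) = (\<Sum>x\<in>UNIV. x)"
      by (rule sum.reindex_bij_witness[of _ "\<lambda>x. x - 1" "\<lambda>x. x + 1"]) auto
    then have "of_nat CARD('a) = (0::'a)"
      by (simp add: sum.distrib)
    then show ?thesis
      unfolding of_nat_eq_0_iff_char_dvd card_F p(2) by (simp add: power_mult)
  qed
  ultimately have "CHAR('a) = p"
    using p(1) prime_dvd_power primes_dvd_imp_eq by blast
  then show ?thesis
    using freshmans_dream'[OF \<open>prime CHAR('a)\<close>, of "q ^ i" "k * i" x y] p(2)
    by (simp add: power_mult)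
qed

lemma frob_minus: "(- x :: 'a) ^ q ^ i = - (x ^ q ^ i)"
proof -
  have "x ^ q ^ i + (- x) ^ q ^ i = 0"
    using frob_add[of x "- x" i] by simp
  then show ?thesis by (metis add.commute eq_neg_iff_add_eq_0)
qed

lemma frob_diff: "(x - y :: 'a) ^ q ^ i = x ^ q ^ i - y ^ q ^ i"
  using frob_add[of x "- y" i] by (simp add: frob_minus)

lemma frob_frob: "((x::'a) ^ q ^ i) ^ q ^ j = x ^ q ^ (i + j)"
  by (simp add: power_add power_mult)

lemma frob_frob': "k = i + j \<Longrightarrow> ((x::'a) ^ q ^ i) ^ q ^ j = x ^ q ^ k"
  by (simp add: frob_frob)

text \<open>Multiplication by a nonzero \<open>x\<close> permutes the nonzero elements, so it preserves their product.\<close>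

lemma frob_5 [simp]: "(x::'a) ^ q ^ 5 = x"
proof (cases "x = 0")
  case False
  have "(\<Prod>y\<in>UNIV - {0}. x * y) = (\<Prod>y\<in>UNIV - {0}. y)"
    by (rule prod.reindex_bij_witness[of _ "\<lambda>y. y / x" "\<lambda>y. x * y"]) (use False in auto)
  then have "x ^ (CARD('a) - 1) * \<Prod>(UNIV - {0::'a}) = \<Prod>(UNIV - {0})"
    by (simp add: prod.distrib)
  then have "x ^ (CARD('a) - 1) = 1"
    by simp
  then have "x ^ Suc (CARD('a) - 1) = x"
    by (metis mult.right_neutral power_Suc)
  then show ?thesis
    by (simp add: card_F[symmetric])
qed (simp)

lemma frob_add_5 [simp]: "(x::'a) ^ q ^ (i + 5) = x ^ q ^ i"
  using frob_frob[of x i 5] by simp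

lemma frob_inj: "(x::'a) ^ q ^ i = y ^ q ^ i \<longleftrightarrow> x = y"
proof
  have *: "z = 0" if "z ^ q ^ i = 0" for z :: 'a
    using that by simp
  show "x = y" if "x ^ q ^ i = y ^ q ^ i"
    using *[of "x - y"] that by (simp add: frob_diff)
qed simp

text \<open>
  As a polynomial in \<open>x\<close> the sum has degree at most \<open>q ^ 4\<close>, and its linear coefficient \<open>c 0\<close>
  does not vanish, so it has fewer than \<open>q ^ 5\<close> roots.
\<close>

lemma trace_functional_nonzero:
  fixes c :: "nat \<Rightarrow> 'a"
  assumes "c 0 \<noteq> 0"
  obtains x where "(\<Sum>i<5. c i * x ^ q ^ i) \<noteq> 0"
proof -
  define p where "p = (\<Sum>i<5. monom (c i) (q ^ i))"
  have inj: "q ^ i = q ^ j \<longleftrightarrow> i = j" for i j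
    using q_gt_1 by simp
  have "coeff p 1 = (\<Sum>i<5. if i = 0 then c i else 0)"
    unfolding p_def coeff_sum coeff_monom using inj[of _ 0]
    by (intro sum.cong) auto
  then have "coeff p 1 \<noteq> 0"
    using assms by simp
  then have "p \<noteq> 0" by auto
  have "degree p \<le> q ^ 4"
    unfolding p_def
  proof (rule degree_sum_le)
    fix i :: nat assume "i \<in> {..<5}"
    then have "q ^ i \<le> q ^ 4"
      using q_gt_1 by (intro power_increasing) auto
    then show "degree (monom (c i) (q ^ i)) \<le> q ^ 4"
      using degree_monom_le order_trans by blast
  qed simp
  then have "card {x. poly p x = 0} \<le> q ^ 4"
    using card_poly_roots_bound[OF \<open>p \<noteq> 0\<close>] by simp
  also have "\<dots> < CARD('a)"
    unfolding card_F using q_gt_1 by (intro power_strict_increasing) auto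
  finally have "{x. poly p x = 0} \<noteq> UNIV" by auto
  then obtain x where "poly p x \<noteq> 0" by blast
  moreover have "poly p x = (\<Sum>i<5. c i * x ^ q ^ i)"
    unfolding p_def by (simp add: poly_sum poly_monom)
  ultimately show thesis using that by metis
qed

definition Tr :: "'a \<Rightarrow> 'a" where "Tr x = (\<Sum>i<5. x ^ q ^ i)"

lemma Tr_add: "Tr (x + y) = Tr x + Tr y"
  unfolding Tr_def by (simp add: frob_add sum.distrib)

lemma Tr_frob: "Tr (x ^ q ^ i) = Tr x"
proof (induction i)
  case (Suc i)
  have "Tr (y ^ q) = Tr y" for y
  proof -
    have "Tr (y ^ q) = (\<Sum>i<5. y ^ q ^ Suc i)"
      unfolding Tr_def by (simp only: power_mult[symmetric] power_Suc)
    then have "y + Tr (y ^ q) = (\<Sum>i<Suc 5. y ^ q ^ i)"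
      unfolding sum.lessThan_Suc_shift by simp
    also have "\<dots> = Tr y + y"
      unfolding Tr_def sum.lessThan_Suc by simp
    finally show ?thesis by simp
  qed
  then show ?case
    using Suc.IH by (simp only: power_Suc2 power_mult)
qed simp

lemma Tr_nondegenerate:
  assumes "\<And>y. Tr (x * y) = 0"
  shows "x = 0"
proof (rule ccontr)
  assume "x \<noteq> 0"
  obtain z :: 'a where "(\<Sum>i<5. 1 * z ^ q ^ i) \<noteq> 0"
    by (rule trace_functional_nonzero[of "\<lambda>_. 1", OF one_neq_zero]) blast
  then have "Tr (x * (z / x)) \<noteq> 0"
    unfolding Tr_def using \<open>x \<noteq> 0\<close> by simp
  then show False using assms by blast
qed

text \<open>
  If \<open>g\<close> were injective, it would be onto, and an \<open>x\<close> with \<open>f x = 0\<close>, being orthogonal to every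
  \<open>g y\<close> for the trace form, would be orthogonal to everything.
\<close>

lemma adjoint_singular:
  assumes adj: "\<And>x y. Tr (f x * y) = Tr (x * g y)"
    and g: "\<And>x y. g (x - y) = g x - g y"
    and x: "x \<noteq> 0" "f x = 0"
  obtains y where "y \<noteq> 0" and "g y = 0"
proof -
  have "\<not> inj g"
  proof
    assume "inj g"
    then have "surj g" by (simp add: finite_UNIV_inj_surj)
    have "Tr (x * w) = 0" for w
    proof -
      obtain y where "w = g y" using \<open>surj g\<close> by blast
      then show ?thesis using adj[of x y] x(2) by (simp add: Tr_def)
    qed
    then show False using Tr_nondegenerate x(1) by blast
  qed
  then obtain y z where "y - z \<noteq> 0" "g (y - z) = 0"
    unfolding inj_def g by auto
  then show thesis using that by blast
qed

section \<open>Linear sets given by linearized polynomials\<close>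

lemma span_pair_eq:
  fixes x y c :: 'a
  assumes "x \<noteq> 0" and "y \<noteq> 0" and "c * x = y * d"
  shows "vec.span {vector [x, d] :: 'a ^ 2} = vec.span {vector [y, c]}"
proof -
  have "(vector [x, d] :: 'a ^ 2) = (x / y) *s vector [y, c]"
    using assms by (simp add: vec_eq_iff forall_2 field_simps)
  then show ?thesis
    using assms(1,2) by (simp add: vec.span_image_scale[of "{vector [y, c]}" "\<lambda>_. x / y", simplified])
qed

text \<open>
  The point \<open>(1, t)\<close> belongs to the set of \<open>f\<close> iff \<open>x \<mapsto> f x - t x\<close> is singular.
  Multiplication by \<open>t\<close> is self-adjoint, so this happens for \<open>f\<close> and its adjoint \<open>g\<close>
  simultaneously.
\<close>

lemma point_set_adjoint:
  fixes f g :: "'a \<Rightarrow> 'a"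
  assumes adj: "\<And>x y. Tr (f x * y) = Tr (x * g y)"
    and f: "\<And>x y. f (x - y) = f x - f y"
    and g: "\<And>x y. g (x - y) = g x - g y"
  shows "point_set (\<lambda>x. vector [x, f x] :: 'a ^ 2) = point_set (\<lambda>x. vector [x, g x])"
proof -
  have half: "point_set (\<lambda>x. vector [x, f x] :: 'a ^ 2) \<subseteq> point_set (\<lambda>x. vector [x, g x])"
    if adj: "\<And>x y. Tr (f x * y) = Tr (x * g y)"
      and g: "\<And>x y. g (x - y) = g x - g y" for f g :: "'a \<Rightarrow> 'a"
  proof
    fix P assume "P \<in> point_set (\<lambda>x. vector [x, f x] :: 'a ^ 2)"
    then obtain x where x: "x \<noteq> 0" "P = vec.span {vector [x, f x]}"
      unfolding point_set_def by blast
    define t where "t = f x / x"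
    have "Tr ((f x' - t * x') * y) = Tr (x' * (g y - t * y))" for x' y
    proof -
      have "Tr ((f x' - t * x') * y) + Tr (t * x' * y) = Tr (x' * (g y - t * y)) + Tr (t * x' * y)"
        unfolding Tr_add[symmetric] using adj by (simp add: algebra_simps)
      then show ?thesis by simp
    qed
    moreover have "g (y - z) - t * (y - z) = (g y - t * y) - (g z - t * z)" for y z
      by (simp add: g algebra_simps)
    moreover have "f x - t * x = 0"
      using x(1) by (simp add: t_def)
    ultimately obtain y where "y \<noteq> 0" "g y - t * y = 0"
      using adjoint_singular[of "\<lambda>x. f x - t * x" "\<lambda>y. g y - t * y" x] x(1) by blast
    then have "P = vec.span {vector [y, g y]}"
      unfolding x(2) using x(1) by (intro span_pair_eq) (auto simp: t_def field_simps)
    then show "P \<in> point_set (\<lambda>x. vector [x, g x])"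
      unfolding point_set_def using \<open>y \<noteq> 0\<close> by blast
  qed
  have "Tr (g x * y) = Tr (x * f y)" for x y
    using adj[of y x] by (simp add: mult.commute)
  then show ?thesis
    using half[OF adj g] half[of g f, OF _ f] by blast
qed

lemma L_alpha_beta_point_set:
  "L_alpha_beta q \<alpha> \<beta> =
    point_set (\<lambda>x::'a. vector [x - \<alpha> * x ^ q ^ 2, x ^ q - \<beta> * x ^ q ^ 2])"
  unfolding L_alpha_beta_def point_set_def ..

lemma pseudoregulus_type_point_set:
  "pseudoregulus_type q L \<longleftrightarrow> proj_equiv L (point_set (\<lambda>u::'a. vector [u, u ^ q]))"
  unfolding pseudoregulus_type_def point_set_def ..

text \<open>
  Choose \<open>\<gamma>\<close> with \<open>\<gamma> ^ q = \<beta>\<close>, so that \<open>\<alpha> = \<gamma> \<beta>\<close>.  Then \<open>z = x - \<gamma> x ^ q\<close> is a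
  combination of the two coordinates, while \<open>z ^ q\<close> is the second coordinate.  As the
  coordinate vector vanishes only for \<open>x = 0\<close>, the additive map \<open>x \<mapsto> z\<close> permutes the field.
\<close>

lemma pseudoregulus_type_degenerate:
  fixes \<alpha> \<beta> :: 'a
  assumes eq: "\<alpha> ^ q = \<beta> ^ (q + 1)"
    and nz: "\<And>x. x \<noteq> 0 \<Longrightarrow> (vector [x - \<alpha> * x ^ q ^ 2, x ^ q - \<beta> * x ^ q ^ 2] :: 'a ^ 2) \<noteq> 0"
  shows "pseudoregulus_type q (L_alpha_beta q \<alpha> \<beta>)"
proof -
  define \<gamma> where "\<gamma> = \<beta> ^ q ^ 4"
  have \<gamma>: "\<gamma> ^ q = \<beta>"
    unfolding \<gamma>_def using frob_frob[of \<beta> 4 1] by simp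
  have "\<alpha> ^ q ^ 1 = (\<gamma> * \<beta>) ^ q ^ 1"
    using eq \<gamma> by (simp add: power_mult_distrib)
  then have \<alpha>: "\<alpha> = \<gamma> * \<beta>"
    unfolding frob_inj .
  define z where "z = (\<lambda>x. x - \<gamma> * x ^ q)"
  have zq: "z x ^ q = x ^ q - \<beta> * x ^ q ^ 2" for x
    using frob_diff[of x "\<gamma> * x ^ q" 1] \<gamma> frob_frob[of x 1 1]
    by (simp add: z_def power_mult_distrib numeral_2_eq_2)
  have z1: "z x = (x - \<alpha> * x ^ q ^ 2) - \<gamma> * z x ^ q" for x
    unfolding zq by (simp add: z_def \<alpha> algebra_simps)
  have z_diff: "z (x - y) = z x - z y" for x y
  proof -
    have "(x - y) ^ q = x ^ q - y ^ q"
      using frob_diff[of x y 1] by simp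
    then show ?thesis unfolding z_def by (simp only:) (simp add: algebra_simps)
  qed
  have "z x \<noteq> 0" if "x \<noteq> 0" for x
  proof
    assume "z x = 0"
    then have "z x ^ q = 0" using frob_0[of 1] by simp
    then have "x - \<alpha> * x ^ q ^ 2 = 0" "x ^ q - \<beta> * x ^ q ^ 2 = 0"
      using z1[of x] \<open>z x = 0\<close> zq[of x] by (metis diff_zero mult_zero_right, metis)
    then show False
      using nz[OF that] by (simp add: vec_eq_iff forall_2)
  qed
  then have "inj z"
    using z_diff by (metis injI right_minus_eq)
  have "(vec.span {vector [1, 0], vector [\<gamma>, 1]} :: ('a ^ 2) set) = UNIV"
  proof -
    have "(vector [1, 0] :: 'a ^ 2) \<notin> vec.span {vector [\<gamma>, 1]}"
      by (auto simp: vec.span_singleton vec_eq_iff forall_2)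
    then show ?thesis
      by (intro span_pair_UNIV) (auto simp: vec_eq_iff forall_2)
  qed
  then obtain M :: "'a ^ 2 ^ 2" where M: "invertible M"
    "\<And>x y. M *v vector [x, y] = x *s vector [1, 0] + y *s vector [\<gamma>, 1]"
    by (rule invertible_from_spanning_pair) blast
  have "proj_equiv (point_set (\<lambda>x. vector [z x, z x ^ q])) (L_alpha_beta q \<alpha> \<beta>)"
    unfolding L_alpha_beta_point_set
  proof (rule proj_equiv_point_set[OF M(1)])
    fix x
    show "M *v vector [z x, z x ^ q] = vector [x - \<alpha> * x ^ q ^ 2, x ^ q - \<beta> * x ^ q ^ 2]"
      unfolding M(2) zq using z1[of x, unfolded zq]
      by (simp add: vec_eq_iff forall_2 mult.commute right_diff_distrib)
  qed
  moreover have "point_set (\<lambda>x. vector [z x, z x ^ q] :: 'a ^ 2) = point_set (\<lambda>u. vector [u, u ^ q])"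
    using point_set_reparam[OF \<open>inj z\<close>, of "\<lambda>u. vector [u, u ^ q]"] q_gt_1 by (simp add: z_def)
  ultimately show ?thesis
    unfolding pseudoregulus_type_point_set using proj_equiv_sym by simp
qed

text \<open>
  The point of \<open>x\<close> on the left is that of \<open>u = x ^ (q + 1)\<close> on the right, both having the slope
  \<open>x ^ (q ^ 2 - 1)\<close>.  Conversely \<open>x = u ^ (- q - q ^ 3)\<close> serves for a given \<open>u\<close>:
  \<open>(q + 1) (q + q ^ 3)\<close> is the norm exponent \<open>1 + q + \<dots> + q ^ 4\<close> minus one, so
  \<open>x ^ (q + 1)\<close> is \<open>u\<close> divided by its norm, and the norm is fixed by \<open>x \<mapsto> x ^ q\<close>.
\<close>

lemma point_set_frob_twice:
  "point_set (\<lambda>x. vector [x, x ^ q ^ 2] :: 'a ^ 2) = point_set (\<lambda>u. vector [u, u ^ q])"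
proof -
  have fwd: "vec.span {vector [x, x ^ q ^ 2] :: 'a ^ 2} =
      vec.span {vector [x ^ (q + 1), (x ^ (q + 1)) ^ q]}" if "x \<noteq> 0" for x
    using that frob_frob[of x 1 1]
    by (intro span_pair_eq) (simp_all add: power_mult_distrib numeral_2_eq_2)
  have bwd: "vec.span {vector [u, u ^ q] :: 'a ^ 2} =
      vec.span {vector [x, x ^ q ^ 2]}" if "u \<noteq> 0" "x = inverse (u ^ q * u ^ q ^ 3)" for u x
  proof (rule span_pair_eq)
    have "(u ^ q) ^ q ^ 2 = u ^ q ^ 3" "(u ^ q ^ 3) ^ q ^ 2 = u"
      using frob_frob'[of 3 1 2 u] frob_frob'[of 5 3 2 u] by simp_all
    then have "x ^ q ^ 2 = inverse (u ^ q ^ 3 * u)"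
      unfolding that(2) power_inverse power_mult_distrib by simp
    then show "x ^ q ^ 2 * u = x * u ^ q"
      unfolding that(2) using that(1) by (simp add: field_simps)
  qed (use that in simp_all)
  show ?thesis
  proof (rule set_eqI, rule iffI)
    fix P assume "P \<in> point_set (\<lambda>x. vector [x, x ^ q ^ 2] :: 'a ^ 2)"
    then obtain x where x: "x \<noteq> 0" "P = vec.span {vector [x, x ^ q ^ 2]}"
      unfolding point_set_def by blast
    then have "x ^ (q + 1) \<noteq> 0" by simp
    then show "P \<in> point_set (\<lambda>u. vector [u, u ^ q] :: 'a ^ 2)"
      unfolding point_set_def x(2) fwd[OF x(1)] by blast
  next
    fix P assume "P \<in> point_set (\<lambda>u. vector [u, u ^ q] :: 'a ^ 2)"
    then obtain u where u: "u \<noteq> 0" "P = vec.span {vector [u, u ^ q]}"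
      unfolding point_set_def by blast
    define x where "x = inverse (u ^ q * u ^ q ^ 3)"
    have "x \<noteq> 0" using u(1) by (simp add: x_def)
    then show "P \<in> point_set (\<lambda>x. vector [x, x ^ q ^ 2] :: 'a ^ 2)"
      unfolding point_set_def u(2) bwd[OF u(1) x_def] by blast
  qed
qed

text \<open>
  The critical case is \<open>a = t b\<close> with \<open>b \<noteq> 0\<close>: the coordinates \<open>x ^ q ^ 2\<close> and \<open>t x + x ^ q\<close> are
  not of the wanted shape, but those given by the adjoint polynomial are, with \<open>\<alpha> = 0\<close> and
  \<open>\<beta> = - t ^ q ^ 2\<close>.  The remaining value \<open>t = 0\<close> belongs to the pseudoregulus type.
\<close>

lemma three_term_linear_set:
  fixes a b c :: "'a ^ 2"
  assumes span: "vec.span {a, b, c} = UNIV"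
    and nz: "\<And>x::'a. x \<noteq> 0 \<Longrightarrow> x *s a + x ^ q *s b + x ^ q ^ 2 *s c \<noteq> 0"
    and L: "L = point_set (\<lambda>x. x *s a + x ^ q *s b + x ^ q ^ 2 *s c)"
    and npr: "\<not> pseudoregulus_type q L"
  shows "\<exists>\<alpha> \<beta>. \<alpha> ^ q \<noteq> \<beta> ^ (q + 1) \<and> proj_equiv L (L_alpha_beta q \<alpha> \<beta>)"
proof -
  consider (ab) "vec.span {a, b} = UNIV" | (b0) "b = 0" "vec.span {a, c} = UNIV"
    | (dep) t where "a = t *s b" "vec.span {c, b} = UNIV"
  proof (cases "b = 0")
    case True
    have "vec.span {a, c} = UNIV"
      using span vec.span_insert_0[of "{a, c}"] unfolding True by (simp add: insert_commute)
    then show thesis by (rule b0[OF True])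
  next
    case b: False
    show thesis
    proof (cases "a \<in> vec.span {b}")
      case True
      have "vec.span {c, b} = UNIV"
      proof -
        have "a \<in> vec.span {b, c}"
          using True vec.span_mono[of "{b}" "{b, c}"] by blast
        then show ?thesis
          using span vec.span_redundant[of a "{b, c}"] by (simp add: insert_commute)
      qed
      then show thesis using True dep unfolding vec.span_singleton by blast
    next
      case False
      then show thesis using ab span_pair_UNIV[OF b] by blast
    qed
  qed
  then show ?thesis
  proof cases
    case ab
    then obtain M :: "'a ^ 2 ^ 2" where M: "invertible M"
      "\<And>x y. M *v vector [x, y] = x *s a + y *s b"
      by (rule invertible_from_spanning_pair) blast
    have "c \<in> vec.span {a, b}" using ab by simp
    then obtain \<alpha>' \<beta>' where "c - \<alpha>' *s a = \<beta>' *s b"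
      unfolding vec.span_breakdown_eq vec.span_singleton by auto
    then have c: "c = \<alpha>' *s a + \<beta>' *s b"
      by (simp add: algebra_simps)
    define \<alpha> \<beta> where "\<alpha> = - \<alpha>'" and "\<beta> = - \<beta>'"
    have Mx: "M *v vector [x - \<alpha> * x ^ q ^ 2, x ^ q - \<beta> * x ^ q ^ 2]
        = x *s a + x ^ q *s b + x ^ q ^ 2 *s c" for x
      unfolding M(2) c \<alpha>_def \<beta>_def
      by (simp add: vec_eq_iff algebra_simps)
    have "proj_equiv (L_alpha_beta q \<alpha> \<beta>) L"
      unfolding L L_alpha_beta_point_set by (rule proj_equiv_point_set[OF M(1) Mx])
    then have equiv: "proj_equiv L (L_alpha_beta q \<alpha> \<beta>)"
      by (rule proj_equiv_sym)
    have "(vector [x - \<alpha> * x ^ q ^ 2, x ^ q - \<beta> * x ^ q ^ 2] :: 'a ^ 2) \<noteq> 0" if "x \<noteq> 0" for x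
      using nz[OF that] unfolding Mx[symmetric] by auto
    then have "\<alpha> ^ q \<noteq> \<beta> ^ (q + 1)"
      using pseudoregulus_type_degenerate[of \<alpha> \<beta>] npr proj_equiv_trans[OF equiv]
      unfolding pseudoregulus_type_def by blast
    with equiv show ?thesis by blast
  next
    case b0
    then obtain M :: "'a ^ 2 ^ 2" where M: "invertible M"
      "\<And>x y. M *v vector [x, y] = x *s a + y *s c"
      by (meson invertible_from_spanning_pair)
    have "proj_equiv (point_set (\<lambda>x. vector [x, x ^ q ^ 2])) L"
      unfolding L b0(1) by (rule proj_equiv_point_set[OF M(1)]) (simp add: M(2))
    then have "pseudoregulus_type q L"
      unfolding point_set_frob_twice pseudoregulus_type_point_set by (rule proj_equiv_sym)
    with npr show ?thesis by blast
  next
    case dep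
    then obtain M :: "'a ^ 2 ^ 2" where M: "invertible M"
      "\<And>x y. M *v vector [x, y] = x *s c + y *s b"
      by (meson invertible_from_spanning_pair)
    \<comment> \<open>\<open>f (x ^ q ^ 2) = t x + x ^ q\<close>, and \<open>g\<close> is the adjoint of \<open>f\<close> for the trace form.\<close>
    define f g :: "'a \<Rightarrow> 'a"
      where "f z = t * z ^ q ^ 3 + z ^ q ^ 4" and "g z = z ^ q + t ^ q ^ 2 * z ^ q ^ 2" for z
    have "point_set (\<lambda>x. vector [x, f x] :: 'a ^ 2)
        = point_set (\<lambda>x. vector [x ^ q ^ 2, t * x + x ^ q])"
    proof -
      have "inj (\<lambda>x::'a. x ^ q ^ 2)" by (simp add: inj_def frob_inj)
      moreover have "f (x ^ q ^ 2) = t * x + x ^ q" for x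
        using frob_frob[of x 2 4] frob_add_5[of x 1] by (simp add: f_def frob_frob)
      ultimately show ?thesis
        using point_set_reparam[of "\<lambda>x. x ^ q ^ 2" "\<lambda>x. vector [x, f x] :: 'a ^ 2"] by simp
    qed
    moreover have "proj_equiv (point_set (\<lambda>x. vector [x ^ q ^ 2, t * x + x ^ q])) L"
      unfolding L dep(1)
      by (rule proj_equiv_point_set[OF M(1)]) (simp add: M(2) vec_eq_iff algebra_simps)
    moreover have "point_set (\<lambda>x. vector [x, f x] :: 'a ^ 2) = point_set (\<lambda>x. vector [x, g x])"
    proof (rule point_set_adjoint)
      fix x y
      show "f (x - y) = f x - f y"
        by (simp add: f_def frob_diff algebra_simps)
      show "g (x - y) = g x - g y"
        using frob_diff[of x y 1] by (simp add: g_def frob_diff algebra_simps)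
      have 1: "Tr (t * x ^ q ^ 3 * y) = Tr (x * (t ^ q ^ 2 * y ^ q ^ 2))"
        using Tr_frob[of "t * x ^ q ^ 3 * y" 2]
        by (simp add: power_mult_distrib frob_frob mult_ac)
      have 2: "Tr (x ^ q ^ 4 * y) = Tr (x * y ^ q)"
        using Tr_frob[of "x ^ q ^ 4 * y" 1] frob_frob[of x 4 1]
        by (simp add: power_mult_distrib)
      show "Tr (f x * y) = Tr (x * g y)"
        by (simp add: f_def g_def distrib_left distrib_right Tr_add 1 2)
    qed
    moreover have "point_set (\<lambda>x. vector [x, g x]) = L_alpha_beta q 0 (- (t ^ q ^ 2))"
      unfolding L_alpha_beta_point_set g_def by simp
    ultimately have equiv: "proj_equiv L (L_alpha_beta q 0 (- (t ^ q ^ 2)))"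
      by (simp add: proj_equiv_sym)
    have "t \<noteq> 0"
    proof
      assume "t = 0"
      then have "pseudoregulus_type q L"
        using equiv unfolding pseudoregulus_type_point_set L_alpha_beta_point_set by simp
      with npr show False by blast
    qed
    then have "(0::'a) ^ q \<noteq> (- (t ^ q ^ 2)) ^ (q + 1)"
      using q_gt_1 by (simp add: power_0_left)
    with equiv show ?thesis by blast
  qed
qed


section \<open>The collineation that fixes the subgeometry\<close>

lemma subgeometry_point_set:
  "subgeometry q = point_set (\<lambda>u::'a. vector [u, u ^ q, u ^ q ^ 2, u ^ q ^ 3, u ^ q ^ 4])"
  unfolding subgeometry_def point_set_def ..

abbreviation (input) \<sigma> :: "'a ^ 5 \<Rightarrow> 'a ^ 5" where "\<sigma> \<equiv> frob_shift q"

lemma shift_add: "\<sigma> (x + y) = \<sigma> x + \<sigma> y"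
  using frob_add[of _ _ 1] by (simp add: frob_shift_def vec_eq_iff)

lemma shift_0: "\<sigma> 0 = 0"
  using frob_0[of 1] by (simp add: frob_shift_def vec_eq_iff)

lemma shift_pow_nth: "(\<sigma> ^^ i) x $ j = (x $ (j - of_nat i)) ^ q ^ i"
proof (induction i arbitrary: j)
  case (Suc i)
  have j: "j - 1 - of_nat i = j - of_nat (Suc i)"
    by (simp add: algebra_simps)
  have "(\<sigma> ^^ Suc i) x $ j = ((\<sigma> ^^ i) x $ (j - 1)) ^ q"
    by (simp add: frob_shift_def[of q "(frob_shift q ^^ i) x"])
  also have "\<dots> = (x $ (j - of_nat (Suc i))) ^ q ^ Suc i"
    unfolding Suc.IH j by (simp only: power_Suc2 power_mult)
  finally show ?case .
qed simp

lemma shift_pow_5: "(\<sigma> ^^ 5) x = x"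
proof -
  have "(of_nat 5 :: 5) = 0" by simp
  then show ?thesis
    unfolding vec_eq_iff shift_pow_nth by (simp only: diff_zero frob_5) simp
qed

lemma shift_pow_scale: "(\<sigma> ^^ i) (c *s x) = c ^ q ^ i *s (\<sigma> ^^ i) x"
  by (simp add: vec_eq_iff shift_pow_nth power_mult_distrib)

lemma shift_pow_add: "(\<sigma> ^^ i) (x + y) = (\<sigma> ^^ i) x + (\<sigma> ^^ i) y"
  by (simp add: vec_eq_iff shift_pow_nth frob_add)

lemma shift_pow_diff: "(\<sigma> ^^ i) (x - y) = (\<sigma> ^^ i) x - (\<sigma> ^^ i) y"
  by (simp add: vec_eq_iff shift_pow_nth frob_diff)

lemma shift_pow_span:
  assumes "x \<in> vec.span S"
  shows "(\<sigma> ^^ i) x \<in> vec.span ((\<sigma> ^^ i) ` S)"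
  using assms
proof (induction rule: vec.span_induct_alt)
  case base
  have "(\<sigma> ^^ i) 0 = 0" using shift_pow_diff[of i 0 0] by simp
  then show ?case by (simp add: vec.span_zero)
next
  case (step c x y)
  then show ?case
    by (simp add: shift_pow_add shift_pow_scale vec.span_add vec.span_scale vec.span_base)
qed

lemma dim_shift_pow_le: "vec.dim ((\<sigma> ^^ i) ` S) \<le> vec.dim S"
proof -
  obtain B where B: "B \<subseteq> S" "vec.independent B" "S \<subseteq> vec.span B" "card B = vec.dim S"
    using vec.basis_exists by blast
  then have "finite B" using vec.finiteI_independent by blast
  have "(\<sigma> ^^ i) ` S \<subseteq> vec.span ((\<sigma> ^^ i) ` B)"
    using shift_pow_span B(3) by blast
  then have "vec.dim ((\<sigma> ^^ i) ` S) \<le> card ((\<sigma> ^^ i) ` B)"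
    using \<open>finite B\<close> by (intro vec.dim_le_card) auto
  also have "\<dots> \<le> vec.dim S"
    using card_image_le[OF \<open>finite B\<close>] B(4) by metis
  finally show ?thesis .
qed

lemma fixed_vector_in_subgeometry:
  assumes "\<sigma> w = w"
  shows "w = vector [w $ 1, (w $ 1) ^ q, (w $ 1) ^ q ^ 2, (w $ 1) ^ q ^ 3, (w $ 1) ^ q ^ 4]"
proof -
  have "(\<sigma> ^^ i) w = w" for i
    by (induction i) (simp_all add: assms)
  then have w: "w $ j = (w $ (j - of_nat i)) ^ q ^ i" for i j
    using shift_pow_nth[of i w j] by simp
  have cases: "i = 1 \<or> i = 2 \<or> i = 3 \<or> i = 4 \<or> i = 0" for i :: 5
  proof (cases i)
    case (of_int z)
    then have "z = 0 \<or> z = 1 \<or> z = 2 \<or> z = 3 \<or> z = 4" by auto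
    with of_int show ?thesis by auto
  qed
  have "of_nat 5 = (0::5)" by simp
  then have five: "(5::5) = 0" by (simp only: of_nat_numeral)
  have "w $ 5 = (w $ 1) ^ q ^ 4"
    using w[of 5 4] by simp
  then have "w $ 0 = (w $ 1) ^ q ^ 4"
    unfolding five .
  moreover have "w $ 2 = (w $ 1) ^ q" "w $ 3 = (w $ 1) ^ q ^ 2" "w $ 4 = (w $ 1) ^ q ^ 3"
    using w[of 2 1] w[of 3 2] w[of 4 3] by simp_all
  ultimately have "w $ i = vector [w $ 1, (w $ 1) ^ q, (w $ 1) ^ q ^ 2, (w $ 1) ^ q ^ 3, (w $ 1) ^ q ^ 4] $ i" for i
    using cases[of i] by (elim disjE) (simp_all add: vector_def)
  then show ?thesis unfolding vec_eq_iff by blast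
qed

lemma shift_orbit_sum: "\<sigma> (\<Sum>i<5. (\<sigma> ^^ i) x) = (\<Sum>i<5. (\<sigma> ^^ i) x)"
proof -
  have "\<sigma> (sum f A) = (\<Sum>i\<in>A. \<sigma> (f i))" for f :: "nat \<Rightarrow> 'a ^ 5" and A
    by (induction A rule: infinite_finite_induct) (simp_all add: shift_0 shift_add)
  then have "x + \<sigma> (\<Sum>i<5. (\<sigma> ^^ i) x) = (\<Sum>i<Suc 5. (\<sigma> ^^ i) x)"
    unfolding sum.lessThan_Suc_shift by simp
  also have "\<dots> = (\<Sum>i<5. (\<sigma> ^^ i) x) + x"
    unfolding sum.lessThan_Suc shift_pow_5 ..
  finally show ?thesis by (simp add: add.commute)
qed

text \<open>
  Galois descent: for \<open>v\<close> in the subspace, the trace \<open>\<Sum>i<5. \<sigma>\<^sup>i (c v)\<close> lies in it and is fixed by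
  \<open>\<sigma>\<close>.  Each of its coordinates is a linearized polynomial in \<open>c\<close>, so a suitable \<open>c\<close> makes it
  nonzero.
\<close>

lemma invariant_subspace_meets_subgeometry:
  assumes S: "vec.subspace S" and inv: "\<And>x. x \<in> S \<Longrightarrow> \<sigma> x \<in> S"
    and v: "v \<in> S" "v \<noteq> 0"
  shows "\<exists>P\<in>subgeometry q. P \<subseteq> S"
proof -
  obtain j where j: "v $ j \<noteq> 0"
    using v(2) unfolding vec_eq_iff by auto
  obtain c where c: "(\<Sum>i<5. (v $ (j - of_nat i)) ^ q ^ i * c ^ q ^ i) \<noteq> 0"
    by (rule trace_functional_nonzero[of "\<lambda>i. (v $ (j - of_nat i)) ^ q ^ i"]) (use j in auto)
  define w where "w = (\<Sum>i<5. (\<sigma> ^^ i) (c *s v))"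
  have inS: "(\<sigma> ^^ i) (c *s v) \<in> S" for i
    by (induction i) (simp_all add: inv S vec.subspace_scale v(1))
  have "w \<in> S"
    unfolding w_def using inS by (intro vec.subspace_sum[OF S])
  have "w $ j = (\<Sum>i<5. (v $ (j - of_nat i)) ^ q ^ i * c ^ q ^ i)"
    unfolding w_def sum_component shift_pow_nth by (simp add: power_mult_distrib mult.commute)
  with c have "w \<noteq> 0" by auto
  have "\<sigma> w = w"
    unfolding w_def by (rule shift_orbit_sum)
  note w = fixed_vector_in_subgeometry[OF this]
  have "w $ 1 \<noteq> 0"
  proof
    assume 0: "w $ 1 = 0"
    have "w = 0"
      by (subst w) (use q_gt_1 in \<open>simp add: 0 vector_def vec_eq_iff power_0_left\<close>)
    with \<open>w \<noteq> 0\<close> show False ..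
  qed
  then have "vec.span {w} \<in> subgeometry q"
    unfolding subgeometry_def
    by (intro CollectI exI[of _ "w $ 1"] conjI arg_cong[where f = "\<lambda>x. vec.span {x}"] w)
  moreover have "vec.span {w} \<subseteq> S"
    using \<open>w \<in> S\<close> S by (simp add: vec.span_minimal)
  ultimately show ?thesis by blast
qed

section \<open>The position of the vertex\<close>

definition orbit :: "'a ^ 5 \<Rightarrow> ('a ^ 5) set" where
  "orbit v = (\<lambda>i. (\<sigma> ^^ i) v) ` {..<5}"

lemma shift_pow_in_orbit: "(\<sigma> ^^ n) v \<in> orbit v"
proof -
  have "(\<sigma> ^^ n) v = (\<sigma> ^^ (n mod 5)) v"
    using funpow_mod_eq[of 5 \<sigma> v n] shift_pow_5 by simp
  then show ?thesis unfolding orbit_def by auto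
qed

text \<open>The span of an orbit is invariant, so it absorbs all images of a set that it contains.\<close>

lemma span_orbit_UNIV:
  assumes "M \<subseteq> vec.span (orbit v)" and "vec.span (\<Union>i<5. (\<sigma> ^^ i) ` M) = UNIV"
  shows "vec.span (orbit v) = UNIV"
proof -
  have "(\<sigma> ^^ i) ` M \<subseteq> vec.span (orbit v)" for i
  proof -
    have "(\<sigma> ^^ i) ` orbit v \<subseteq> orbit v"
      unfolding orbit_def
      using shift_pow_in_orbit[unfolded orbit_def] by (auto simp: funpow_add[symmetric, THEN fun_cong, simplified])
    then have "vec.span ((\<sigma> ^^ i) ` orbit v) \<subseteq> vec.span (orbit v)"
      by (rule vec.span_mono)
    then show ?thesis
      using shift_pow_span[of _ "orbit v" i] assms(1) by blast
  qed
  then have "(\<Union>i<5. (\<sigma> ^^ i) ` M) \<subseteq> vec.span (orbit v)" by blast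
  then have "vec.span (\<Union>i<5. (\<sigma> ^^ i) ` M) \<subseteq> vec.span (orbit v)"
    by (intro vec.span_minimal) auto
  with assms(2) show ?thesis by blast
qed

text \<open>
  Suppose first that \<open>v, \<sigma> v, \<sigma>\<^sup>2 v\<close> all lie in \<open>\<Lambda>\<close> for some \<open>v \<noteq> 0\<close>.  A dependency among them
  would make the span of the first one or two invariant, which descent forbids inside \<open>\<Lambda>\<close>.  So
  they span \<open>\<Lambda>\<close>, and the orbit of \<open>v\<close> spans whatever the images of \<open>\<Lambda>\<close> span.

  Otherwise \<open>M = \<Lambda> \<inter> \<sigma> \<Lambda>\<close> and \<open>K = \<sigma>\<^sup>-\<^sup>1 M\<close> are subspaces of \<open>\<Lambda>\<close> of equal dimension that
  meet only in \<open>0\<close>.  As \<open>\<Lambda>\<close> has dimension three, \<open>M\<close> is spanned by one vector \<open>\<sigma> v\<close>.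
\<close>

lemma vertex_contains_consecutive_pair:
  assumes \<Lambda>: "vec.subspace \<Lambda>" "vec.dim \<Lambda> = 3"
    and disj: "\<forall>P\<in>subgeometry q. \<not> P \<subseteq> \<Lambda>"
    and span: "vec.span (\<Union>i<5. (\<sigma> ^^ i) ` (\<Lambda> \<inter> \<sigma> ` \<Lambda>)) = UNIV"
  obtains v where "v \<in> \<Lambda>" and "\<sigma> v \<in> \<Lambda>" and "vec.span (orbit v) = UNIV"
proof -
  have K_sub: "vec.subspace {x \<in> \<Lambda>. (\<sigma> ^^ i) x \<in> \<Lambda>}" for i
  proof -
    have "(\<sigma> ^^ i) 0 \<in> \<Lambda>"
      using shift_pow_diff[of i 0 0] \<Lambda>(1) by (simp add: vec.subspace_0)
    then show ?thesis
      using \<Lambda>(1) by (auto simp: vec.subspace_def shift_pow_add shift_pow_scale)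
  qed
  \<comment> \<open>\<open>\<sigma>\<^sup>4\<close> is the inverse of \<open>\<sigma>\<close>, so \<open>M\<close> is \<open>\<Lambda> \<inter> \<sigma> \<Lambda>\<close> and \<open>M = \<sigma> K\<close>.\<close>
  define K M where "K = {x \<in> \<Lambda>. (\<sigma> ^^ 1) x \<in> \<Lambda>}" and "M = {x \<in> \<Lambda>. (\<sigma> ^^ 4) x \<in> \<Lambda>}"
  have \<sigma>4: "\<sigma> ((\<sigma> ^^ 4) x) = x" "(\<sigma> ^^ 4) (\<sigma> x) = x" for x
    using shift_pow_5[of x] funpow_swap1[of \<sigma> 4 x] by (simp_all add: eval_nat_numeral)
  have M: "\<Lambda> \<inter> \<sigma> ` \<Lambda> = M"
  proof (rule set_eqI, rule iffI)
    fix x assume "x \<in> \<Lambda> \<inter> \<sigma> ` \<Lambda>"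
    then show "x \<in> M" unfolding M_def by (auto simp: \<sigma>4(2))
  next
    fix x assume "x \<in> M"
    then show "x \<in> \<Lambda> \<inter> \<sigma> ` \<Lambda>"
      unfolding M_def using image_eqI[of x \<sigma> "(\<sigma> ^^ 4) x" \<Lambda>] by (simp only: \<sigma>4(1)) blast
  qed
  show thesis
  proof (cases "\<exists>v. v \<noteq> 0 \<and> v \<in> \<Lambda> \<and> \<sigma> v \<in> \<Lambda> \<and> \<sigma> (\<sigma> v) \<in> \<Lambda>")
    case True
    then obtain v where v: "v \<noteq> 0" "v \<in> \<Lambda>" "\<sigma> v \<in> \<Lambda>" "\<sigma> (\<sigma> v) \<in> \<Lambda>"
      by blast
    have no_inv: "\<sigma> x \<notin> vec.span B" if "v \<in> B" "B \<subseteq> \<Lambda>" "\<sigma> ` B \<subseteq> insert (\<sigma> x) B" for x B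
    proof
      assume "\<sigma> x \<in> vec.span B"
      then have "insert (\<sigma> x) B \<subseteq> vec.span B"
        by (simp add: vec.span_superset)
      with that(3) have "\<sigma> ` B \<subseteq> vec.span B"
        by (rule order_trans)
      then have "\<sigma> y \<in> vec.span B" if "y \<in> vec.span B" for y
        using shift_pow_span[OF that, of 1] vec.span_minimal[OF _ vec.subspace_span, of "\<sigma> ` B" B]
        by auto
      moreover have "vec.span B \<subseteq> \<Lambda>"
        using that(2) \<Lambda>(1) by (rule vec.span_minimal)
      moreover have "\<exists>P\<in>subgeometry q. P \<subseteq> vec.span B"
        using calculation(1) v(1) that(1)
        by (intro invariant_subspace_meets_subgeometry[of _ v]) (auto simp: vec.span_base)
      ultimately show False using disj by blast
    qed
    have "\<sigma> v \<notin> vec.span {v}"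
      by (rule no_inv) (use v in auto)
    moreover have "\<sigma> (\<sigma> v) \<notin> vec.span {\<sigma> v, v}"
      by (rule no_inv) (use v in auto)
    ultimately have "vec.dim {\<sigma> (\<sigma> v), \<sigma> v, v} = 3"
      using v(1) by (simp add: vec.dim_insert)
    then have "\<Lambda> = vec.span {\<sigma> (\<sigma> v), \<sigma> v, v}"
      using v \<Lambda> by (intro vec.subspace_dim_equal[symmetric]) (auto simp: vec.span_minimal)
    also have "\<dots> \<subseteq> vec.span (orbit v)"
      using shift_pow_in_orbit[of 0 v] shift_pow_in_orbit[of 1 v] shift_pow_in_orbit[of 2 v]
      by (intro vec.span_mono) (simp add: numeral_2_eq_2)
    finally have "\<Lambda> \<inter> \<sigma> ` \<Lambda> \<subseteq> vec.span (orbit v)" by blast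
    then show thesis
      using that v span_orbit_UNIV[OF _ span] by blast
  next
    case False
    have "K \<inter> M \<subseteq> {0}"
    proof
      fix x assume "x \<in> K \<inter> M"
      then have "x \<in> \<Lambda>" "\<sigma> x \<in> \<Lambda>" "(\<sigma> ^^ 4) x \<in> \<Lambda>"
        unfolding K_def M_def by auto
      then have "(\<sigma> ^^ 4) x = 0"
        using False \<sigma>4(1)[of x] by metis
      then show "x \<in> {0}"
        using \<sigma>4(1)[of x] shift_0 by simp
    qed
    then have "vec.dim (K \<inter> M) = 0" by simp
    moreover have "vec.dim {x + y |x y. x \<in> K \<and> y \<in> M} \<le> vec.dim \<Lambda>"
      using \<Lambda>(1) by (intro vec.dim_subset) (auto simp: K_def M_def vec.subspace_add)
    ultimately have "vec.dim K + vec.dim M \<le> 3"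
      using vec.dim_sums_Int[of K M] K_sub[of 1] K_sub[of 4] \<Lambda>(2)
      unfolding K_def M_def by linarith
    moreover have "M \<subseteq> (\<sigma> ^^ 1) ` K"
    proof
    fix x assume "x \<in> M"
    then have "(\<sigma> ^^ 4) x \<in> K"
      unfolding K_def M_def by (simp add: \<sigma>4(1))
    then show "x \<in> (\<sigma> ^^ 1) ` K"
      by (rule rev_image_eqI) (simp add: \<sigma>4(1))
  qed
    then have "vec.dim M \<le> vec.dim K"
      using vec.dim_subset dim_shift_pow_le order_trans by blast
    ultimately have "vec.dim M \<le> 1" by linarith
    obtain B where B: "B \<subseteq> M" "vec.independent B" "M \<subseteq> vec.span B" "card B = vec.dim M"
      using vec.basis_exists by blast
    then have "finite B" "card B \<le> Suc 0"
      using vec.finiteI_independent \<open>vec.dim M \<le> 1\<close> by auto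
    then have B_eq: "x = y" if "x \<in> B" "y \<in> B" for x y
      using that card_le_Suc0_iff_eq by blast
    have "0 \<in> M"
      using K_sub[of 4] unfolding M_def by (rule vec.subspace_0)
    have "\<exists>w\<in>M. B \<subseteq> {w}"
    proof (cases "B = {}")
      case True
      then show ?thesis using \<open>0 \<in> M\<close> by blast
    next
      case False
      then show ?thesis using B(1) B_eq by blast
    qed
    then obtain w where "B \<subseteq> {w}" "w \<in> M" by blast
    then have w: "M \<subseteq> vec.span {w}" "w \<in> M"
      using B(3) vec.span_mono[of B "{w}"] by auto
    define v where "v = (\<sigma> ^^ 4) w"
    have "\<sigma> v = w" unfolding v_def by (rule \<sigma>4)
    have "v \<in> \<Lambda>" "\<sigma> v \<in> \<Lambda>"
      using w(2) unfolding M_def \<open>\<sigma> v = w\<close> by (simp_all add: v_def)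
    moreover have "M \<subseteq> vec.span (orbit v)"
      using w(1) shift_pow_in_orbit[of 1 v] \<open>\<sigma> v = w\<close> vec.span_mono[of "{w}" "orbit v"] by auto
    ultimately show thesis
      using that span_orbit_UNIV[OF _ span[unfolded M]] by blast
  qed
qed

section \<open>The projection in coordinates\<close>

text \<open>
  The whole space is the direct sum of \<open>\<Lambda>\<close> and the line, and \<open>G\<close> is the component in the line,
  read in the coordinates of the line.
\<close>

lemma projection_linear_map:
  fixes L :: "('a ^ 2) set set"
  assumes \<Lambda>: "vec.subspace \<Lambda>" "vec.dim \<Lambda> = 3" and L: "is_projection q \<Lambda> L"
  obtains G :: "'a ^ 5 \<Rightarrow> 'a ^ 2"
  where "Vector_Spaces.linear (*s) (*s) G" and "surj G" and "{x. G x = 0} = \<Lambda>"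
    and "L = (\<lambda>P. G ` P) ` subgeometry q"
proof -
  obtain l and g :: "'a ^ 2 \<Rightarrow> 'a ^ 5" where l: "proj_line l" "\<Lambda> \<inter> l = {0}"
    and g: "Vector_Spaces.linear (*s) (*s) g" "inj g" "range g = l"
    and gL: "(\<lambda>P. g ` P) ` L = projection_on q \<Lambda> l"
    using L unfolding is_projection_def by blast
  have l_sub: "vec.subspace l" "vec.dim l = 2"
    using l(1) unfolding proj_line_def proj_dim_def by auto
  have g_add: "g (x + y) = g x + g y" and g_scale: "g (c *s x) = c *s g x" for c x y
    using g(1) by (simp_all add: vec.linear_add vec.linear_scale)
  have g_diff: "g (x - y) = g x - g y" for x y
    using g(1) by (rule vec.linear_diff)
  let ?S = "{x + y |x y. x \<in> \<Lambda> \<and> y \<in> l}"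
  have "vec.dim ?S = 5"
    using vec.dim_sums_Int[OF \<Lambda>(1) l_sub(1)] \<Lambda>(2) l_sub(2) l(2) by simp
  then have "vec.span ?S = UNIV"
    by (intro span_UNIV_if_dim) simp
  then have S: "?S = UNIV"
    using vec.span_eq_iff[THEN iffD2, OF vec.subspace_sums[OF \<Lambda>(1) l_sub(1)]] by simp
  have ex: "\<exists>c. x - g c \<in> \<Lambda>" for x
  proof -
    have "x \<in> ?S" unfolding S by simp
    then obtain a b where "x = a + b" "a \<in> \<Lambda>" "b \<in> l" by blast
    then obtain c where "x = a + g c" "a \<in> \<Lambda>"
      unfolding g(3)[symmetric] by blast
    then show ?thesis by (intro exI[of _ c]) simp
  qed
  have uniq: "c = d" if "x - g c \<in> \<Lambda>" "x - g d \<in> \<Lambda>" for x c d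
  proof -
    have "(x - g d) - (x - g c) \<in> \<Lambda>"
      using that \<Lambda>(1) vec.subspace_diff by blast
    then have "g (c - d) \<in> \<Lambda>" by (simp add: g_diff)
    then have "g (c - d) \<in> \<Lambda> \<inter> l" using g(3) by blast
    then have "g c = g d" unfolding l(2) by (simp add: g_diff)
    then show ?thesis using g(2) by (simp add: inj_eq)
  qed
  define G where "G x = (SOME c. x - g c \<in> \<Lambda>)" for x
  have Gx: "x - g (G x) \<in> \<Lambda>" for x
    unfolding G_def using ex by (rule someI_ex)
  have G_eq: "G x = c \<longleftrightarrow> x - g c \<in> \<Lambda>" for x c
    using Gx uniq by blast
  have "Vector_Spaces.linear (*s) (*s) G"
    unfolding Vector_Spaces.linear_iff
  proof (intro conjI allI vec.vector_space_axioms)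
    show "G (x + y) = G x + G y" for x y
      unfolding G_eq g_add using vec.subspace_add[OF \<Lambda>(1) Gx Gx, of x y] by (simp add: algebra_simps)
    show "G (c *s x) = c *s G x" for c x
      unfolding G_eq g_scale using vec.subspace_scale[OF \<Lambda>(1) Gx, of c x]
      by (simp add: vec.scale_right_diff_distrib)
  qed
  moreover have "G (g c) = c" for c
    unfolding G_eq using \<Lambda>(1) by (simp add: vec.subspace_0)
  then have "surj G" by (metis surjI)
  moreover have "{x. G x = 0} = \<Lambda>"
    unfolding G_eq using g(1) by (simp add: vec.linear_0)
  moreover have "L = (\<lambda>P. G ` P) ` subgeometry q"
  proof -
    have "vec.span (\<Lambda> \<union> P) \<inter> l = g ` G ` P" if "P \<in> subgeometry q" for P
    proof -
      have "vec.subspace P"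
        using that unfolding subgeometry_def by auto
      then have sum: "vec.span (\<Lambda> \<union> P) = {x + y |x y. x \<in> \<Lambda> \<and> y \<in> P}"
        using \<Lambda>(1) unfolding vec.span_Un by (simp add: vec.span_eq_iff[THEN iffD2])
      show ?thesis
      proof (rule set_eqI, rule iffI)
        fix y assume "y \<in> vec.span (\<Lambda> \<union> P) \<inter> l"
        then obtain a b c where "y = a + b" "a \<in> \<Lambda>" "b \<in> P" "y = g c"
          unfolding sum using g(3) by auto
        moreover from this have "b - g c = - a" by simp
        with \<open>a \<in> \<Lambda>\<close> have "G b = c"
          unfolding G_eq using vec.subspace_neg[OF \<Lambda>(1), of a]
          by simp
        ultimately show "y \<in> g ` G ` P" by blast
      next
        fix y assume "y \<in> g ` G ` P"
        then obtain b where b: "b \<in> P" "y = g (G b)" by blast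
        have "y = - (b - g (G b)) + b" by (simp add: b)
        moreover have "- (b - g (G b)) \<in> \<Lambda>"
          using vec.subspace_neg[OF \<Lambda>(1) Gx] .
        ultimately show "y \<in> vec.span (\<Lambda> \<union> P) \<inter> l"
          unfolding sum using b g(3) by blast
      qed
    qed
    then have "projection_on q \<Lambda> l = (\<lambda>P. g ` P) ` (\<lambda>P. G ` P) ` subgeometry q"
      unfolding projection_on_def Setcompr_eq_image image_image by (intro image_cong refl)
    then have "(\<lambda>P. g ` P) ` L = (\<lambda>P. g ` P) ` (\<lambda>P. G ` P) ` subgeometry q"
      using gL by simp
    moreover have "inj (\<lambda>P. g ` P)"
      using g(2) by (simp add: inj_def inj_image_eq_iff)
    ultimately show ?thesis
      by (simp only: inj_image_eq_iff)
  qed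
  ultimately show thesis using that by blast
qed

text \<open>
  The sums are the traces of \<open>y \<sigma>\<^sup>k v\<close>, so they are fixed by \<open>\<sigma>\<close> and hence of the form
  \<open>(u, u ^ q, \<dots>)\<close>.  The basis property of the orbit makes \<open>y \<mapsto> u\<close> injective, and an injective
  self-map of a finite field is onto.
\<close>

lemma subgeometry_orbit_sums:
  assumes v: "vec.span (orbit v) = UNIV"
  shows "subgeometry q = point_set (\<lambda>y. \<Sum>i<5. y ^ q ^ i *s (\<sigma> ^^ (i + k)) v)"
proof -
  define Y where "Y y = (\<Sum>i<5. y ^ q ^ i *s (\<sigma> ^^ (i + k)) v)" for y
  have Y: "Y y = (\<Sum>i<5. (\<sigma> ^^ i) (y *s (\<sigma> ^^ k) v))" for y
    unfolding Y_def by (simp add: shift_pow_scale funpow_add)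
  have fixed: "\<sigma> (Y y) = Y y" for y
    unfolding Y by (rule shift_orbit_sum)
  have Y_diff: "Y (x - y) = Y x - Y y" for x y
    unfolding Y by (simp add: vec.scale_left_diff_distrib shift_pow_diff sum_subtractf)
  have Y_nz: "y = 0" if "Y y = 0" for y
  proof (rule ccontr)
    assume "y \<noteq> 0"
    define e where "e i = (\<sigma> ^^ (i + k)) v" for i
    let ?S = "vec.span (e ` {..<4})"
    have e: "e i \<in> ?S" if "i < 4" for i
      using that by (simp add: vec.span_base)
    \<comment> \<open>A relation with nonzero coefficients lets four vectors span the whole orbit.\<close>
    have "y ^ q ^ 4 *s e 4 = - (\<Sum>i<4. y ^ q ^ i *s e i)"
    proof -
      have "Y y = (\<Sum>i<4. y ^ q ^ i *s e i) + y ^ q ^ 4 *s e 4"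
        unfolding Y_def e_def using sum.lessThan_Suc[of "\<lambda>i. y ^ q ^ i *s (\<sigma> ^^ (i + k)) v" 4] by simp
      then show ?thesis using \<open>Y y = 0\<close> by (simp add: eq_neg_iff_add_eq_0 add.commute)
    qed
    also have "\<dots> \<in> ?S"
      using e by (intro vec.span_neg vec.span_sum vec.span_scale) auto
    finally have "inverse (y ^ q ^ 4) *s (y ^ q ^ 4 *s e 4) \<in> ?S"
      by (rule vec.span_scale)
    then have "e 4 \<in> ?S"
      using \<open>y \<noteq> 0\<close> by simp
    then have e5: "e i \<in> ?S" if "i < 5" for i
      using e that by (cases "i = 4") auto
    have e_mod: "e i = e (i mod 5)" for i
      using funpow_mod_eq[of 5 \<sigma> "(\<sigma> ^^ k) v" i] shift_pow_5 by (simp add: e_def funpow_add)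
    have "(\<sigma> ^^ j) v \<in> ?S" for j
    proof -
      \<comment> \<open>\<open>j + 4 k + k\<close> is congruent to \<open>j\<close> modulo the order five of \<open>\<sigma>\<close>.\<close>
      have "e (j + 4 * k) = (\<sigma> ^^ j) v"
        using funpow_mod_eq[of 5 \<sigma> v "j + 4 * k + k"] funpow_mod_eq[of 5 \<sigma> v j] shift_pow_5
        by (simp add: e_def)
      then show ?thesis using e5[of "(j + 4 * k) mod 5"] e_mod by simp
    qed
    then have "orbit v \<subseteq> ?S" unfolding orbit_def by blast
    then have "UNIV \<subseteq> ?S"
      using v vec.span_minimal[OF _ vec.subspace_span] by metis
    then have "vec.dim (UNIV :: ('a ^ 5) set) \<le> card (e ` {..<4})"
      by (intro vec.dim_le_card) auto
    also have "\<dots> \<le> 4"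
      using card_image_le[of "{..<4}" e] by simp
    finally show False unfolding vec_dim_card by simp
  qed
  have Y1: "Y y = vector [Y y $ 1, (Y y $ 1) ^ q, (Y y $ 1) ^ q ^ 2, (Y y $ 1) ^ q ^ 3, (Y y $ 1) ^ q ^ 4]" for y
    by (rule fixed_vector_in_subgeometry[OF fixed])
  have "inj (\<lambda>y. Y y $ 1)"
  proof (rule injI)
    fix x y assume "Y x $ 1 = Y y $ 1"
    then have "Y x = Y y" by (subst (1 2) Y1) simp
    then show "x = y" using Y_nz[of "x - y"] by (simp add: Y_diff)
  qed
  moreover have "Y 0 = 0" unfolding Y_def by simp
  ultimately show ?thesis
    unfolding subgeometry_point_set Y_def[symmetric]
    using point_set_reparam[of "\<lambda>y. Y y $ 1" "\<lambda>u. vector [u, u ^ q, u ^ q ^ 2, u ^ q ^ 3, u ^ q ^ 4] :: 'a ^ 5"]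
    by (simp only: Y1[symmetric] zero_index)
qed

end

theorem proposition2p4:
  fixes q :: nat
    and L :: "('a::{field,finite} ^ 2) set set"
    and \<Lambda> :: "('a ^ 5) set"
  assumes "primepow q"
    and "CARD('a) = q ^ 5"
    and "maximum_scattered q L"
    and "\<not> pseudoregulus_type q L"
    and "proj_plane \<Lambda>"
    and "\<forall>P \<in> subgeometry q. \<not> P \<subseteq> \<Lambda>"
    and "is_projection q \<Lambda> L"
    and "height q (\<Lambda> \<inter> frob_shift q ` \<Lambda>) = 4"
  shows "\<exists>\<alpha> \<beta> :: 'a. \<alpha> ^ q \<noteq> \<beta> ^ (q + 1) \<and> proj_equiv L (L_alpha_beta q \<alpha> \<beta>)"
proof -
  interpret quintic_extension q "TYPE('a)"
    using assms(1,2) by unfold_locales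
  have \<Lambda>: "vec.subspace \<Lambda>" "vec.dim \<Lambda> = 3"
    using assms(5) unfolding proj_plane_def proj_dim_def by auto
  have "vec.dim (vec.span (\<Union>i<5. (\<sigma> ^^ i) ` (\<Lambda> \<inter> \<sigma> ` \<Lambda>))) = 5"
    using assms(8) unfolding height_def proj_dim_def by simp
  then have "vec.span (\<Union>i<5. (\<sigma> ^^ i) ` (\<Lambda> \<inter> \<sigma> ` \<Lambda>)) = UNIV"
    unfolding vec.dim_span by (intro span_UNIV_if_dim) simp
  from vertex_contains_consecutive_pair[OF \<Lambda> assms(6) this]
  obtain v where v: "v \<in> \<Lambda>" "\<sigma> v \<in> \<Lambda>" "vec.span (orbit v) = UNIV" .
  from projection_linear_map[OF \<Lambda> assms(7)]
  obtain G :: "'a ^ 5 \<Rightarrow> 'a ^ 2" where G: "Vector_Spaces.linear (*s) (*s) G" "surj G"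
    "{x. G x = 0} = \<Lambda>" "L = (\<lambda>P. G ` P) ` subgeometry q" .
  \<comment> \<open>The shift by two puts the higher powers \<open>y ^ q ^ 3\<close>, \<open>y ^ q ^ 4\<close> on \<open>v\<close> and \<open>\<sigma> v\<close>, which \<open>G\<close> kills.\<close>
  define Y where "Y y = (\<Sum>i<5. y ^ q ^ i *s (\<sigma> ^^ (i + 2)) v)" for y
  have subgeo: "subgeometry q = point_set Y"
    unfolding Y_def by (rule subgeometry_orbit_sums[OF v(3)])
  define a b c where "a = G ((\<sigma> ^^ 2) v)" and "b = G ((\<sigma> ^^ 3) v)" and "c = G ((\<sigma> ^^ 4) v)"
  have G01: "G v = 0" "G (\<sigma> v) = 0"
    using v G(3) by auto
  have G56: "G ((\<sigma> ^^ 5) v) = 0" "G ((\<sigma> ^^ 6) v) = 0"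
  proof -
    have "(\<sigma> ^^ 6) v = \<sigma> ((\<sigma> ^^ 5) v)" by (simp add: eval_nat_numeral)
    then show "G ((\<sigma> ^^ 5) v) = 0" "G ((\<sigma> ^^ 6) v) = 0"
      using G01 unfolding shift_pow_5 by simp_all
  qed
  have GY: "G (Y y) = y *s a + y ^ q *s b + y ^ q ^ 2 *s c" for y
  proof -
    have "{..<5} = {0, 1, 2, 3, 4::nat}" by auto
    then have "Y y = y *s (\<sigma> ^^ 2) v + y ^ q *s (\<sigma> ^^ 3) v + y ^ q ^ 2 *s (\<sigma> ^^ 4) v
        + y ^ q ^ 3 *s (\<sigma> ^^ 5) v + y ^ q ^ 4 *s (\<sigma> ^^ 6) v"
      unfolding Y_def by (simp add: numeral_eq_Suc add.assoc)
    then show ?thesis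
      unfolding a_def b_def c_def
      by (simp only: vec.linear_add[OF G(1)] vec.linear_scale[OF G(1)] G56) simp
  qed
  have "vec.span {a, b, c} = UNIV"
  proof -
    have "{..<5} = {0, 1, 2, 3, 4::nat}" by auto
    then have "G ` orbit v = {0, a, b, c}"
      unfolding orbit_def a_def b_def c_def using G01 by simp
    then have "vec.span {0, a, b, c} = range G"
      using vec.linear_span_image[OF G(1), of "orbit v"] v(3) by simp
    then show ?thesis using G(2) by simp
  qed
  moreover have "x *s a + x ^ q *s b + x ^ q ^ 2 *s c \<noteq> 0" if "x \<noteq> 0" for x
  proof
    assume "x *s a + x ^ q *s b + x ^ q ^ 2 *s c = 0"
    then have "Y x \<in> \<Lambda>" using GY[of x] G(3) by auto
    then have "vec.span {Y x} \<subseteq> \<Lambda>"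
      using \<Lambda>(1) by (simp add: vec.span_minimal)
    moreover have "vec.span {Y x} \<in> subgeometry q"
      unfolding subgeo point_set_def using that by blast
    ultimately show False using assms(6) by blast
  qed
  moreover have "L = point_set (\<lambda>x. x *s a + x ^ q *s b + x ^ q ^ 2 *s c)"
  proof -
    have "G ` vec.span {Y x} = vec.span {G (Y x)}" for x
      using vec.linear_span_image[OF G(1), of "{Y x}"] by simp
    then show ?thesis
      unfolding G(4) subgeo point_set_def GY[symmetric] by (auto simp: image_iff)
  qed
  ultimately show ?thesis
    using assms(4) by (rule three_term_linear_set)
qed

end
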